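(* Let $(\kappa,f),(\kappa',f')$ be elements of the set $$\{(\kappa,f)\in\mathrm{RP}_n^0\times\{+,-\}^{\times n}\mid f(i)=f(j)\text{ whenever }\kappa_i=\kappa_j\}.$$ For the corresponding reduced parabolic subalgebras of $\mathfrak{pe}(n)$ we have $\mathfrak p(\kappa,f)\subseteq\mathfrak p(\kappa',f')$ if and only if $(\kappa,f)\le(\kappa',f')$.
   Context: **Periplectic Lie superalgebra.** $\mathfrak g=\mathfrak{pe}(n)=\left\{\begin{pmatrix}A&B\\C&-A^t\end{pmatrix}: A,B,C\in\mathbb C^{n\times n},\ B^t=B,\ C^t=-C\right\}\subset\mathfrak{gl}(n|n)$ with supercommutator bracket. $\mathfrak h$ is the subalgebra of diagonal matrices, $\epsilon_1,\dots,\epsilon_n\in\mathfrak h^*$ the basis dual to $\{E_{ii}-E_{n+i,n+i}\}$, $(\cdot,\cdot)$ the form with $(\epsilon_i,\epsilon_j)=\delta_{ij}$. Roots: $\Phi=\{\epsilon_i-\epsilon_j\mid i\ne j\}$ (even) $\sqcup\{\epsilon_i+\epsilon_j\mid i\le j\}\sqcup\{-\epsilon_i-\epsilon_j\mid i<j\}$ (odd). For $\delta\in\mathfrak h^*$, $\mathfrak p(\delta)=\bigoplus_{\alpha\in\Phi\cup\{0\},\,\mathrm{Re}(\delta,\alpha)\ge0}\mathfrak g^\alpha$. **Combinatorics.** $\mathrm{RP}_n^0$ is the set of partitions $\kappa=(\kappa_1\ge\kappa_2\ge\cdots)$ of length exactly $n$ with $0\le\kappa_i-\kappa_{i+1}\le1$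 for all $i\ge1$ (so $\kappa_n=1$). A pair $(\kappa,f)$ as in the claim, with $f:\{1,\dots,n\}\to\{+,-\}$, corresponds to the bipartition $(\mu,\nu)$ where $\mu$ consists of the parts $\kappa_i$ with $f(i)=+$ and $\nu$ of the parts $\kappa_i$ with $f(i)=-$ (each in weakly decreasing order). The associated reduced parabolic subalgebra is $\mathfrak p(\kappa,f):=\mathfrak p(\delta)$ with $\delta=\sum_{i\ge1}\mu_i\epsilon_i-\sum_{j\ge1}\nu_j\epsilon_{n+1-j}$. **Partial order.** $(\kappa,f)\le(\kappa',f')$ if and only if (1) $(\kappa_1-\kappa_1',\kappa_2-\kappa_2',\dots)$ is a partition (weakly decreasing sequence of non-negative integers), and (2) $f(i)=f'(i)$ for $i<n$ and $(f(n),f'(n))\in\{(-,+),(+,+),(-,-)\}$. *)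

theory Defs
  imports Complex_Main "HOL-Library.FuncSet" "Jordan_Normal_Form.Matrix"
begin

(* All indices are shifted by one against the mathematical text: rows, columns, the basis
   vectors eps_i, the parts kappa_i and the signs f(i) are numbered 0, ..., n - 1. *)

section \<open>The periplectic Lie superalgebra\<close>

definition even_part :: "nat \<Rightarrow> complex mat \<Rightarrow> complex mat" where
  "even_part n X = mat (n + n) (n + n) (\<lambda>(i, j). if (i < n) = (j < n) then X $$ (i, j) else 0)"

definition odd_part :: "nat \<Rightarrow> complex mat \<Rightarrow> complex mat" where
  "odd_part n X = mat (n + n) (n + n) (\<lambda>(i, j). if (i < n) = (j < n) then 0 else X $$ (i, j))"

(* The bilinear extension of [X, Y] = X Y - (-1)^(|X| |Y|) Y X from homogeneous elements
   to gl(n|n). *)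
definition super_bracket :: "nat \<Rightarrow> complex mat \<Rightarrow> complex mat \<Rightarrow> complex mat" where
  "super_bracket n X Y =
     X * Y - (even_part n Y * even_part n X + even_part n Y * odd_part n X
              + odd_part n Y * even_part n X - odd_part n Y * odd_part n X)"

definition pe :: "nat \<Rightarrow> complex mat set" where
  "pe n = {four_block_mat A B C (- A\<^sup>T) | A B C.
             A \<in> carrier_mat n n \<and> B \<in> carrier_mat n n \<and> C \<in> carrier_mat n n \<and>
             B\<^sup>T = B \<and> C\<^sup>T = - C}"

definition cartan :: "nat \<Rightarrow> complex mat set" where
  "cartan n = {H \<in> pe n. diagonal_mat H}"

(* Elements of the dual of the Cartan subalgebra are given by their coordinate vectors in
   the basis eps.  As eps is dual to E_(i,i) - E_(n+i,n+i), eps_i maps a diagonal H in pe(n)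
   to its (i,i) entry, and the form with (eps_i, eps_j) = delta_ij is the (complex bilinear)
   scalar product of coordinate vectors. *)
abbreviation eps :: "nat \<Rightarrow> nat \<Rightarrow> complex vec" where
  "eps n i \<equiv> unit_vec n i"

definition weight_eval :: "nat \<Rightarrow> complex vec \<Rightarrow> complex mat \<Rightarrow> complex" where
  "weight_eval n w H = (\<Sum>i<n. w $ i * H $$ (i, i))"

definition root_space :: "nat \<Rightarrow> complex vec \<Rightarrow> complex mat set" where
  "root_space n \<alpha> = {X \<in> pe n. \<forall>H\<in>cartan n. super_bracket n H X = weight_eval n \<alpha> H \<cdot>\<^sub>m X}"

definition roots :: "nat \<Rightarrow> complex vec set" where
  "roots n = {eps n i - eps n j | i j. i < n \<and> j < n \<and> i \<noteq> j}
           \<union> {eps n i + eps n j | i j. i \<le> j \<and> j < n}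
           \<union> {- eps n i - eps n j | i j. i < j \<and> j < n}"

(* The direct sum of root spaces is the internal one: the set of all sums of elements of
   the respective root spaces (the root space of 0 included). *)
definition parabolic :: "nat \<Rightarrow> complex vec \<Rightarrow> complex mat set" where
  "parabolic n \<delta> =
     (let S = {\<alpha> \<in> roots n \<union> {0\<^sub>v n}. Re (\<delta> \<bullet> \<alpha>) \<ge> 0}
      in {finsum (module_mat TYPE(complex) (n + n) (n + n)) X S | X. X \<in> (\<Pi> \<alpha>\<in>S. root_space n \<alpha>)})"

section \<open>Combinatorics\<close>

definition is_partition :: "(nat \<Rightarrow> int) \<Rightarrow> bool" where
  "is_partition \<kappa> \<longleftrightarrow> antimono \<kappa> \<and> (\<forall>i. \<kappa> i \<ge> 0) \<and> finite {i. \<kappa> i \<noteq> 0}"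

definition partition_length :: "(nat \<Rightarrow> int) \<Rightarrow> nat" where
  "partition_length \<kappa> = card {i. \<kappa> i \<noteq> 0}"

definition RP0 :: "nat \<Rightarrow> (nat \<Rightarrow> int) set" where
  "RP0 n = {\<kappa>. is_partition \<kappa> \<and> partition_length \<kappa> = n \<and>
               (\<forall>i. 0 \<le> \<kappa> i - \<kappa> (Suc i) \<and> \<kappa> i - \<kappa> (Suc i) \<le> 1)}"

datatype pm = Pos | Neg

definition signed_partitions :: "nat \<Rightarrow> ((nat \<Rightarrow> int) \<times> (nat \<Rightarrow> pm)) set" where
  "signed_partitions n =
     {(\<kappa>, f) \<in> RP0 n \<times> ({..<n} \<rightarrow>\<^sub>E UNIV). \<forall>i<n. \<forall>j<n. \<kappa> i = \<kappa> j \<longrightarrow> f i = f j}"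

(* The parts with sign s, as a list; it is weakly decreasing because kappa is. *)
definition parts_of_sign :: "nat \<Rightarrow> pm \<Rightarrow> (nat \<Rightarrow> int) \<times> (nat \<Rightarrow> pm) \<Rightarrow> int list" where
  "parts_of_sign n s = (\<lambda>(\<kappa>, f). map \<kappa> (filter (\<lambda>i. f i = s) [0..<n]))"

definition bipartition_weight :: "nat \<Rightarrow> int list \<Rightarrow> int list \<Rightarrow> complex vec" where
  "bipartition_weight n \<mu> \<nu> =
     finsum_vec TYPE(complex) n (\<lambda>i. of_int (\<mu> ! i) \<cdot>\<^sub>v eps n i) {..<length \<mu>}
     - finsum_vec TYPE(complex) n (\<lambda>j. of_int (\<nu> ! j) \<cdot>\<^sub>v eps n (n - 1 - j)) {..<length \<nu>}"

definition reduced_parabolic :: "nat \<Rightarrow> (nat \<Rightarrow> int) \<times> (nat \<Rightarrow> pm) \<Rightarrow> complex mat set" where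
  "reduced_parabolic n p =
     parabolic n (bipartition_weight n (parts_of_sign n Pos p) (parts_of_sign n Neg p))"

definition signed_partition_le ::
  "nat \<Rightarrow> (nat \<Rightarrow> int) \<times> (nat \<Rightarrow> pm) \<Rightarrow> (nat \<Rightarrow> int) \<times> (nat \<Rightarrow> pm) \<Rightarrow> bool" where
  "signed_partition_le n = (\<lambda>(\<kappa>, f) (\<kappa>', f').
     is_partition (\<lambda>i. \<kappa> i - \<kappa>' i) \<and>
     (\<forall>i<n - 1. f i = f' i) \<and>
     (f (n - 1), f' (n - 1)) \<in> {(Neg, Pos), (Pos, Pos), (Neg, Neg)})"

end

theory Submission
  imports Defs
begin

text \<open>
  An inclusion of parabolic subalgebras amounts to an inclusion of their sets of roots, because
  every root space is detected by a matrix entry on which the other root spaces vanish.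
  The coordinates of the weight of a signed partition are its signed parts in permuted order.
  If \<open>f\<close> and \<open>f'\<close> first differ at an index before the last, the odd
  root supported on the two coordinates holding the part at that index would force equal parts of
  \<open>\<kappa>'\<close> with opposite signs. Hence the signs agree except possibly at the last part,
  both permutations coincide, and the conditions on roots become conditions on pairs of parts.
\<close>

section \<open>Entries of root vectors\<close>

definition opposite :: "nat \<Rightarrow> nat \<Rightarrow> nat" where
  "opposite n r = (if r < n then n + r else r - n)"

text \<open>The sign with which an entry reappears at its reflected position: plus for the symmetric
  upper right block, minus for the other three blocks.\<close>

definition mirror_sign :: "nat \<Rightarrow> nat \<Rightarrow> nat \<Rightarrow> complex" where
  "mirror_sign n r c = (if r < n \<and> n \<le> c then 1 else - 1)"

text \<open>The weight of the \<open>r\<close>-th standard basis vector under the Cartan subalgebra;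
  position \<open>(r, c)\<close> then has weight \<open>index_weight n r - index_weight n c\<close>
  in all four blocks.\<close>

definition index_weight :: "nat \<Rightarrow> nat \<Rightarrow> complex vec" where
  "index_weight n r = (if r < n then eps n r else - eps n (r - n))"

lemma index_weight_carrier [simp]: "index_weight n r \<in> carrier_vec n"
  by (simp add: index_weight_def)

lemma dim_index_weight [simp]: "dim_vec (index_weight n r) = n"
  by (simp add: index_weight_def)

lemma opposite_less [simp]: "r < n + n \<Longrightarrow> opposite n r < n + n"
  by (auto simp: opposite_def)

lemma opposite_opposite [simp]: "r < n + n \<Longrightarrow> opposite n (opposite n r) = r"
  by (auto simp: opposite_def)

lemma opposite_eq_iff:
  "r < n + n \<Longrightarrow> s < n + n \<Longrightarrow> opposite n r = opposite n s \<longleftrightarrow> r = s"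
  by (metis opposite_opposite)

lemma mirror_sign_square [simp]: "mirror_sign n r c * mirror_sign n r c = 1"
  by (simp add: mirror_sign_def)

lemma mirror_sign_opposite [simp]:
  "r < n + n \<Longrightarrow> c < n + n \<Longrightarrow>
    mirror_sign n (opposite n c) (opposite n r) = mirror_sign n r c"
  by (auto simp: opposite_def mirror_sign_def)

text \<open>The shape of the lower right block, the symmetry of \<open>B\<close> and the skew
  symmetry of \<open>C\<close> are instances of one reflection, which maps \<open>(r, c)\<close> to
  \<open>(opposite n c, opposite n r)\<close>. This form avoids case splits by blocks.\<close>

lemma pe_iff:
  "X \<in> pe n \<longleftrightarrow> X \<in> carrier_mat (n + n) (n + n) \<and>
     (\<forall>r<n + n. \<forall>c<n + n. X $$ (opposite n c, opposite n r) = mirror_sign n r c * X $$ (r, c))"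
  (is "_ \<longleftrightarrow> ?R")
proof
  assume "X \<in> pe n"
  then obtain A B C where X: "X = four_block_mat A B C (- A\<^sup>T)"
    and A: "A \<in> carrier_mat n n" and B: "B \<in> carrier_mat n n" and C: "C \<in> carrier_mat n n"
    and Bs: "B\<^sup>T = B" and Cs: "C\<^sup>T = - C"
    unfolding pe_def by blast
  have b: "B $$ (i, j) = B $$ (j, i)" if "i < n" "j < n" for i j
    using arg_cong[OF Bs, of "\<lambda>M. M $$ (i, j)"] that B by simp
  have c: "C $$ (i, j) = - C $$ (j, i)" if "i < n" "j < n" for i j
    using arg_cong[OF Cs, of "\<lambda>M. M $$ (j, i)"] that C by simp
  show ?R
    using A B C unfolding X opposite_def mirror_sign_def
    by (auto intro: b c)
next
  assume R: ?R
  define A where "A = mat n n (\<lambda>(i, j). X $$ (i, j))"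
  define B where "B = mat n n (\<lambda>(i, j). X $$ (i, n + j))"
  define C where "C = mat n n (\<lambda>(i, j). X $$ (n + i, j))"
  have X: "X $$ (opposite n c, opposite n r) = mirror_sign n r c * X $$ (r, c)"
    if "r < n + n" "c < n + n" for r c using R that by blast
  have XA: "X $$ (n + j, n + i) = - X $$ (i, j)" if "i < n" "j < n" for i j
    using X[of i j] that by (simp add: opposite_def mirror_sign_def)
  have XB: "X $$ (j, n + i) = X $$ (i, n + j)" if "i < n" "j < n" for i j
    using X[of i "n + j"] that by (simp add: opposite_def mirror_sign_def)
  have XC: "X $$ (n + j, i) = - X $$ (n + i, j)" if "i < n" "j < n" for i j
    using X[of "n + i" j] that by (simp add: opposite_def mirror_sign_def)
  have "B\<^sup>T = B" "C\<^sup>T = - C"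
    unfolding B_def C_def by (auto intro!: eq_matI XB XC)
  moreover have "X = four_block_mat A B C (- A\<^sup>T)"
  proof (rule eq_matI)
    fix i j
    assume "i < dim_row (four_block_mat A B C (- A\<^sup>T))" "j < dim_col (four_block_mat A B C (- A\<^sup>T))"
    hence ij: "i < n + n" "j < n + n" by (auto simp: A_def)
    show "X $$ (i, j) = four_block_mat A B C (- A\<^sup>T) $$ (i, j)"
    proof (cases "i < n")
      case True
      thus ?thesis using ij by (simp add: A_def B_def C_def)
    next
      case False
      then obtain i' where i': "i = n + i'" "i' < n"
        using ij by (metis add_less_cancel_left le_Suc_ex not_less)
      show ?thesis
      proof (cases "j < n")
        case True
        thus ?thesis using i' by (simp add: A_def B_def C_def)
      next
        case False
        then obtain j' where j': "j = n + j'" "j' < n"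
          using ij by (metis add_less_cancel_left le_Suc_ex not_less)
        thus ?thesis using i' XA[of j' i'] by (simp add: A_def B_def C_def)
      qed
    qed
  qed (use R in \<open>auto simp: A_def\<close>)
  moreover have "A \<in> carrier_mat n n" "B \<in> carrier_mat n n" "C \<in> carrier_mat n n"
    by (simp_all add: A_def B_def C_def)
  ultimately show "X \<in> pe n" unfolding pe_def by blast
qed

section \<open>Action of the Cartan subalgebra on entries\<close>

lemma cartan_opposite:
  assumes "H \<in> cartan n" "i < n"
  shows "H $$ (n + i, n + i) = - H $$ (i, i)"
proof -
  have "H $$ (opposite n i, opposite n i) = mirror_sign n i i * H $$ (i, i)"
    using assms unfolding cartan_def pe_iff by (simp del: opposite_opposite)
  thus ?thesis using assms(2) by (simp add: opposite_def mirror_sign_def)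
qed

lemma cartan_carrier: "H \<in> cartan n \<Longrightarrow> H \<in> carrier_mat (n + n) (n + n)"
  by (simp add: cartan_def pe_iff)

lemma cartan_diagonal: "H \<in> cartan n \<Longrightarrow> i < n + n \<Longrightarrow> j < n + n \<Longrightarrow> i \<noteq> j \<Longrightarrow> H $$ (i, j) = 0"
  using cartan_carrier[of H n] by (auto simp: cartan_def diagonal_mat_def)

definition diag_element :: "nat \<Rightarrow> (nat \<Rightarrow> complex) \<Rightarrow> complex mat" where
  "diag_element n h =
     mat (n + n) (n + n) (\<lambda>(i, j). if i = j then if i < n then h i else - h (i - n) else 0)"

lemma diag_element_cartan: "diag_element n h \<in> cartan n"
proof -
  have "diag_element n h \<in> pe n"
    unfolding pe_iff
  proof (intro conjI allI impI)
    fix r c assume r: "r < n + n" and c: "c < n + n"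
    show "diag_element n h $$ (opposite n c, opposite n r) = mirror_sign n r c * diag_element n h $$ (r, c)"
    proof (cases "r = c")
      case True
      thus ?thesis using r by (auto simp: diag_element_def mirror_sign_def opposite_def)
    next
      case False
      thus ?thesis using r c by (simp add: diag_element_def opposite_eq_iff)
    qed
  qed (simp add: diag_element_def)
  thus ?thesis by (simp add: cartan_def diagonal_mat_def diag_element_def)
qed

text \<open>\<open>H\<close> is diagonal, hence even, so the bracket is the ordinary commutator even
  for inhomogeneous \<open>X\<close>, and a commutator with a diagonal matrix scales each entry
  separately.\<close>

lemma super_bracket_cartan:
  assumes H: "H \<in> cartan n" and X: "X \<in> carrier_mat (n + n) (n + n)"
    and r: "r < n + n" and c: "c < n + n"
  shows "super_bracket n H X $$ (r, c) = (H $$ (r, r) - H $$ (c, c)) * X $$ (r, c)"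
proof -
  note Hc = cartan_carrier[OF H] and Hd = cartan_diagonal[OF H]
  have e: "even_part n H = H"
    using Hc by (auto intro!: eq_matI simp: even_part_def Hd)
  have o: "odd_part n H = 0\<^sub>m (n + n) (n + n)"
    using Hc by (auto intro!: eq_matI simp: odd_part_def Hd)
  have left: "(H * X) $$ (r, c) = H $$ (r, r) * X $$ (r, c)"
  proof -
    have "(H * X) $$ (r, c) = (\<Sum>k = 0..<n + n. H $$ (r, k) * X $$ (k, c))"
      using Hc X r c by (simp add: scalar_prod_def)
    also have "\<dots> = (\<Sum>k = 0..<n + n. if k = r then H $$ (r, r) * X $$ (r, c) else 0)"
      using r by (intro sum.cong) (auto simp: Hd)
    finally show ?thesis using r by simp
  qed
  have right: "(Y * H) $$ (r, c) = Y $$ (r, c) * H $$ (c, c)"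
    if Y: "Y \<in> carrier_mat (n + n) (n + n)" for Y
  proof -
    have "(Y * H) $$ (r, c) = (\<Sum>k = 0..<n + n. Y $$ (r, k) * H $$ (k, c))"
      using Hc Y r c by (simp add: scalar_prod_def)
    also have "\<dots> = (\<Sum>k = 0..<n + n. if k = c then Y $$ (r, c) * H $$ (c, c) else 0)"
      using c by (intro sum.cong) (auto simp: Hd)
    finally show ?thesis using c by simp
  qed
  have E: "even_part n X \<in> carrier_mat (n + n) (n + n)" and O: "odd_part n X \<in> carrier_mat (n + n) (n + n)"
    by (simp_all add: even_part_def odd_part_def)
  have "even_part n X $$ (r, c) + odd_part n X $$ (r, c) = X $$ (r, c)"
    using r c by (simp add: even_part_def odd_part_def)
  hence "X $$ (r, c) * H $$ (c, c) = even_part n X $$ (r, c) * H $$ (c, c) + odd_part n X $$ (r, c) * H $$ (c, c)"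
    by (metis distrib_right)
  moreover have "super_bracket n H X $$ (r, c) =
      H $$ (r, r) * X $$ (r, c)
      - (even_part n X $$ (r, c) * H $$ (c, c) + odd_part n X $$ (r, c) * H $$ (c, c))"
    unfolding super_bracket_def e o using Hc X E O r c
    by (simp add: left right del: index_mult_mat(1))
  ultimately show ?thesis by (simp add: algebra_simps)
qed

lemma weight_eval_index_weight:
  assumes H: "H \<in> cartan n" and r: "r < n + n" and c: "c < n + n"
  shows "weight_eval n (index_weight n r - index_weight n c) H = H $$ (r, r) - H $$ (c, c)"
proof -
  have *: "(\<Sum>i<n. index_weight n s $ i * H $$ (i, i)) = H $$ (s, s)" if s: "s < n + n" for s
  proof (cases "s < n")
    case True
    hence "(\<Sum>i<n. index_weight n s $ i * H $$ (i, i)) = (\<Sum>i<n. if i = s then H $$ (s, s) else 0)"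
      by (intro sum.cong) (auto simp: index_weight_def)
    thus ?thesis using True by simp
  next
    case False
    hence "(\<Sum>i<n. index_weight n s $ i * H $$ (i, i)) = (\<Sum>i<n. if i = s - n then - H $$ (s - n, s - n) else 0)"
      using s by (intro sum.cong) (auto simp: index_weight_def)
    thus ?thesis using False s cartan_opposite[OF H, of "s - n"] by simp
  qed
  have "weight_eval n (index_weight n r - index_weight n c) H =
      (\<Sum>i<n. index_weight n r $ i * H $$ (i, i) - index_weight n c $ i * H $$ (i, i))"
    unfolding weight_eval_def
    by (intro sum.cong) (auto simp: left_diff_distrib)
  thus ?thesis using * r c by (simp add: sum_subtractf)
qed

text \<open>Cartan elements with a single 1 among the first \<open>n\<close> diagonal entries read
  off one coordinate of a weight at a time.\<close>

lemma weight_eval_inject: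
  assumes v: "v \<in> carrier_vec n" and w: "w \<in> carrier_vec n"
    and eq: "\<And>H. H \<in> cartan n \<Longrightarrow> weight_eval n v H = weight_eval n w H"
  shows "v = w"
proof (rule eq_vecI)
  fix i assume "i < dim_vec w"
  hence i: "i < n" using w by simp
  have *: "weight_eval n u (diag_element n (\<lambda>j. if j = i then 1 else 0)) = u $ i" for u
  proof -
    have "weight_eval n u (diag_element n (\<lambda>j. if j = i then 1 else 0)) = (\<Sum>j<n. if j = i then u $ i else 0)"
      unfolding weight_eval_def diag_element_def by (intro sum.cong) auto
    thus ?thesis using i by simp
  qed
  show "v $ i = w $ i"
    using eq[OF diag_element_cartan[of n "\<lambda>j. if j = i then 1 else 0"]] unfolding * .
qed (use v w in auto)

section \<open>Root spaces and root vectors\<close>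

lemma root_space_iff:
  "X \<in> root_space n \<alpha> \<longleftrightarrow> X \<in> pe n \<and>
     (\<forall>r<n + n. \<forall>c<n + n. \<forall>H\<in>cartan n.
        (H $$ (r, r) - H $$ (c, c)) * X $$ (r, c) = weight_eval n \<alpha> H * X $$ (r, c))"
proof -
  have "super_bracket n H X = weight_eval n \<alpha> H \<cdot>\<^sub>m X \<longleftrightarrow>
      (\<forall>r<n + n. \<forall>c<n + n.
        (H $$ (r, r) - H $$ (c, c)) * X $$ (r, c) = weight_eval n \<alpha> H * X $$ (r, c))"
    if X: "X \<in> pe n" and H: "H \<in> cartan n" for H
  proof -
    from X have Xc: "X \<in> carrier_mat (n + n) (n + n)" by (simp add: pe_iff)
    have dims: "dim_row (super_bracket n H X) = n + n" "dim_col (super_bracket n H X) = n + n"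
      unfolding super_bracket_def odd_part_def even_part_def by simp_all
    show ?thesis
      using Xc by (auto simp: mat_eq_iff dims super_bracket_cartan[OF H Xc])
  qed
  thus ?thesis unfolding root_space_def by blast
qed

text \<open>The eigenvalue equation at \<open>(r, c)\<close> can be divided by the nonzero entry,
  for every \<open>H\<close>. Contrapositively, root spaces of other weights vanish at
  \<open>(r, c)\<close>.\<close>

lemma root_space_weight_unique:
  assumes X: "X \<in> root_space n \<alpha>" and \<alpha>: "\<alpha> \<in> carrier_vec n"
    and r: "r < n + n" and c: "c < n + n" and nz: "X $$ (r, c) \<noteq> 0"
  shows "\<alpha> = index_weight n r - index_weight n c"
proof (rule weight_eval_inject[OF \<alpha>])
  fix H assume H: "H \<in> cartan n"
  hence "(H $$ (r, r) - H $$ (c, c)) * X $$ (r, c) = weight_eval n \<alpha> H * X $$ (r, c)"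
    using X r c by (meson root_space_iff)
  thus "weight_eval n \<alpha> H = weight_eval n (index_weight n r - index_weight n c) H"
    using nz weight_eval_index_weight[OF H r c] by simp
qed simp

text \<open>The matrix unit at \<open>(r, c)\<close> completed by reflection. If the position is its
  own reflection, the first branch wins and the entry stays 1.\<close>

definition root_vector :: "nat \<Rightarrow> nat \<Rightarrow> nat \<Rightarrow> complex mat" where
  "root_vector n r c = mat (n + n) (n + n) (\<lambda>(i, j).
     if i = r \<and> j = c then 1
     else if i = opposite n c \<and> j = opposite n r then mirror_sign n r c else 0)"

text \<open>The excluded entries are the diagonal entries of the skew-symmetric block.\<close>

lemma root_vector_in_root_space:
  assumes r: "r < n + n" and c: "c < n + n" and rc: "\<not> (n \<le> r \<and> r = opposite n c)"
  shows "root_vector n r c \<in> root_space n (index_weight n r - index_weight n c)"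
proof -
  \<comment> \<open>A self-reflected position lies on the diagonal of an off-diagonal block;
    \<open>rc\<close> leaves only the symmetric block, whose sign is 1.\<close>
  have 1: "mirror_sign n r c = 1" if "opposite n c = r"
    using rc that r c by (auto simp: mirror_sign_def opposite_def split: if_splits)
  have entry: "root_vector n r c $$ (i, j) = (if i = r \<and> j = c then 1
      else if i = opposite n c \<and> j = opposite n r then mirror_sign n r c else 0)"
    if "i < n + n" "j < n + n" for i j
    using that by (simp add: root_vector_def)
  have "root_vector n r c \<in> pe n"
    unfolding pe_iff
  proof (intro conjI allI impI)
    fix i j assume i: "i < n + n" and j: "j < n + n"
    show "root_vector n r c $$ (opposite n j, opposite n i) = mirror_sign n i j * root_vector n r c $$ (i, j)"
    proof (cases "i = r \<and> j = c")
      case True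
      thus ?thesis using r c 1 by (auto simp: root_vector_def)
    next
      case False
      show ?thesis
      proof (cases "i = opposite n c \<and> j = opposite n r")
        case True
        thus ?thesis using False r c by (auto simp: root_vector_def)
      next
        case False': False
        have 2: "\<not> (opposite n j = r \<and> opposite n i = c)"
          using False' i j by auto
        have 3: "\<not> (opposite n j = opposite n c \<and> opposite n i = opposite n r)"
          using False i j r c by (auto simp: opposite_eq_iff)
        show ?thesis
          unfolding entry[OF i j] entry[OF opposite_less[OF j] opposite_less[OF i]]
          by (simp only: False False' 2 3 if_False mult_zero_right)
      qed
    qed
  qed (simp add: root_vector_def)
  moreover have "(H $$ (i, i) - H $$ (j, j)) * root_vector n r c $$ (i, j) =
      weight_eval n (index_weight n r - index_weight n c) H * root_vector n r c $$ (i, j)"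
    if i: "i < n + n" and j: "j < n + n" and H: "H \<in> cartan n" for i j H
  proof -
    \<comment> \<open>Reflection negates both diagonal entries of \<open>H\<close> and swaps their
      order, so the reflected position has the same weight.\<close>
    have op: "H $$ (opposite n s, opposite n s) = - H $$ (s, s)" if "s < n + n" for s
      using that cartan_opposite[OF H, of s] cartan_opposite[OF H, of "s - n"]
      by (auto simp: opposite_def)
    show ?thesis
      unfolding weight_eval_index_weight[OF H r c]
      using r c by (simp add: entry[OF i j] op)
  qed
  ultimately show ?thesis by (simp add: root_space_iff)
qed

lemma zero_in_root_space: "0\<^sub>m (n + n) (n + n) \<in> root_space n \<alpha>"
  by (simp add: root_space_iff pe_iff)

lemma root_space_carrier: "X \<in> root_space n \<alpha> \<Longrightarrow> X \<in> carrier_mat (n + n) (n + n)"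
  by (simp add: root_space_def pe_iff)

section \<open>Roots as weights of matrix positions\<close>

lemma roots_carrier: "roots n \<subseteq> carrier_vec n"
  by (auto simp: roots_def)

lemma finite_roots: "finite (roots n)"
proof -
  have "roots n \<subseteq> (\<lambda>(i, j). eps n i - eps n j) ` ({..<n} \<times> {..<n})
      \<union> (\<lambda>(i, j). eps n i + eps n j) ` ({..<n} \<times> {..<n})
      \<union> (\<lambda>(i, j). - eps n i - eps n j) ` ({..<n} \<times> {..<n})"
    by (auto simp: roots_def)
  thus ?thesis by (rule finite_subset) auto
qed

lemma roots_cases:
  assumes "\<alpha> \<in> roots n"
  obtains (minus) i j where "i < n" "j < n" "i \<noteq> j" "\<alpha> = eps n i - eps n j"
    | (plus) i j where "i \<le> j" "j < n" "\<alpha> = eps n i + eps n j"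
    | (neg) i j where "i < j" "j < n" "\<alpha> = - eps n i - eps n j"
  using assms unfolding roots_def
  by (elim UnE CollectE exE conjE)
    ((rule minus; assumption), (rule plus; assumption), (rule neg; assumption))

text \<open>Differences are realised in the upper left block, sums in the upper right, negative sums
  in the lower left, where \<open>i < j\<close> keeps off the zero diagonal.\<close>

lemma root_index_weight:
  assumes "\<alpha> \<in> roots n"
  obtains r c where "r < n + n" "c < n + n" "\<not> (n \<le> r \<and> r = opposite n c)"
    "\<alpha> = index_weight n r - index_weight n c"
  using assms
proof (cases rule: roots_cases)
  case (minus i j)
  thus ?thesis by (intro that[of i j]) (auto simp: index_weight_def)
next
  case (plus i j)
  thus ?thesis by (intro that[of i "n + j"]) (auto simp: index_weight_def)
next
  case (neg i j)
  thus ?thesis by (intro that[of "n + i" j]) (auto simp: index_weight_def opposite_def)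
qed

section \<open>Inclusion of parabolic subalgebras\<close>

lemma finsum_module_mat:
  assumes "finite S" "X \<in> S \<rightarrow> carrier_mat nr nc"
  shows "finsum (module_mat TYPE('a :: comm_ring_1) nr nc) X S = mat nr nc (\<lambda>ij. \<Sum>s\<in>S. X s $$ ij)"
  using assms
proof (induction S)
  interpret abelian_group "module_mat TYPE('a) nr nc" by (rule abelian_group_mat)
  case empty
  show ?case by (auto intro!: eq_matI simp: module_mat_simps)
next
  interpret abelian_group "module_mat TYPE('a) nr nc" by (rule abelian_group_mat)
  case (insert s S)
  hence "finsum (module_mat TYPE('a) nr nc) X (insert s S) = X s + finsum (module_mat TYPE('a) nr nc) X S"
    by (subst finsum_insert) (auto simp: module_mat_simps)
  also have "\<dots> = mat nr nc (\<lambda>ij. \<Sum>t\<in>insert s S. X t $$ ij)"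
    using insert by (auto intro!: eq_matI)
  finally show ?case .
qed

text \<open>A root vector for \<open>\<alpha>\<close> has a nonzero entry at which every vector of another weight vanishes,
  so a parabolic subalgebra determines the roots it contains.\<close>

lemma parabolic_subset_iff:
  assumes d: "\<delta> \<in> carrier_vec n" and d': "\<delta>' \<in> carrier_vec n"
  shows "parabolic n \<delta> \<subseteq> parabolic n \<delta>' \<longleftrightarrow>
    (\<forall>\<alpha>\<in>roots n. Re (\<delta> \<bullet> \<alpha>) \<ge> 0 \<longrightarrow> Re (\<delta>' \<bullet> \<alpha>) \<ge> 0)"
proof -
  define S where "S v = {\<alpha> \<in> roots n \<union> {0\<^sub>v n}. Re (v \<bullet> \<alpha>) \<ge> 0}" for v
  define F where "F X v = mat (n + n) (n + n) (\<lambda>ij. \<Sum>\<alpha>\<in>S v. X \<alpha> $$ ij)"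
    for X :: "complex vec \<Rightarrow> complex mat" and v
  have fin: "finite (S v)" for v
    unfolding S_def using finite_roots by simp
  have Scarrier: "\<alpha> \<in> carrier_vec n" if "\<alpha> \<in> S v" for \<alpha> v
    using that roots_carrier by (auto simp: S_def)
  have par: "parabolic n v = {F X v | X. X \<in> (\<Pi> \<alpha>\<in>S v. root_space n \<alpha>)}" for v
  proof -
    have "finsum (module_mat TYPE(complex) (n + n) (n + n)) X (S v) = F X v"
      if "X \<in> (\<Pi> \<alpha>\<in>S v. root_space n \<alpha>)" for X
      unfolding F_def using that by (intro finsum_module_mat fin) (auto dest: root_space_carrier)
    thus ?thesis unfolding parabolic_def Let_def S_def[symmetric] by (metis (no_types, lifting))
  qed
  show ?thesis
  proof
    assume sub: "parabolic n \<delta> \<subseteq> parabolic n \<delta>'"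
    show "\<forall>\<alpha>\<in>roots n. Re (\<delta> \<bullet> \<alpha>) \<ge> 0 \<longrightarrow> Re (\<delta>' \<bullet> \<alpha>) \<ge> 0"
    proof (intro ballI impI)
      fix \<alpha> assume \<alpha>: "\<alpha> \<in> roots n" "Re (\<delta> \<bullet> \<alpha>) \<ge> 0"
      then obtain r c where rc: "r < n + n" "c < n + n" "\<not> (n \<le> r \<and> r = opposite n c)"
        and eq: "\<alpha> = index_weight n r - index_weight n c"
        by (metis root_index_weight)
      \<comment> \<open>The family concentrated at \<alpha> sums to the root vector, whose entry at
        \<open>(r, c)\<close> is 1.\<close>
      define X where "X \<beta> = (if \<beta> = \<alpha> then root_vector n r c else 0\<^sub>m (n + n) (n + n))" for \<beta>
      have "\<alpha> \<in> S \<delta>" using \<alpha> by (simp add: S_def)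
      have "X \<beta> \<in> root_space n \<beta>" for \<beta>
        using root_vector_in_root_space[OF rc] zero_in_root_space by (simp add: X_def eq)
      hence "F X \<delta> \<in> parabolic n \<delta>'" using sub unfolding par by blast
      then obtain Y where Y: "Y \<in> (\<Pi> \<alpha>\<in>S \<delta>'. root_space n \<alpha>)" and XY: "F X \<delta> = F Y \<delta>'"
        unfolding par by blast
      have "(\<Sum>\<beta>\<in>S \<delta>. X \<beta> $$ (r, c)) = (\<Sum>\<beta>\<in>S \<delta>. if \<beta> = \<alpha> then 1 else 0)"
        using rc by (intro sum.cong) (auto simp: X_def root_vector_def)
      hence "F X \<delta> $$ (r, c) = 1"
        using rc fin \<open>\<alpha> \<in> S \<delta>\<close> by (simp add: F_def)
      hence "(\<Sum>\<beta>\<in>S \<delta>'. Y \<beta> $$ (r, c)) \<noteq> 0"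
        using rc unfolding XY by (simp add: F_def)
      \<comment> \<open>The nonzero entry has to come from some summand of the other decomposition,
        and the weight of that summand must be \<alpha>.\<close>
      then obtain \<beta> where \<beta>: "\<beta> \<in> S \<delta>'" "Y \<beta> $$ (r, c) \<noteq> 0"
        by (meson sum.neutral)
      hence "\<beta> = \<alpha>"
        using root_space_weight_unique[of "Y \<beta>" n \<beta> r c] Y Scarrier rc eq by blast
      thus "Re (\<delta>' \<bullet> \<alpha>) \<ge> 0" using \<beta>(1) by (simp add: S_def)
    qed
  next
    assume imp: "\<forall>\<alpha>\<in>roots n. Re (\<delta> \<bullet> \<alpha>) \<ge> 0 \<longrightarrow> Re (\<delta>' \<bullet> \<alpha>) \<ge> 0"
    \<comment> \<open>The weight 0 pairs to 0 with \<delta>', so the condition on roots extends to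
      it.\<close>
    hence sub: "S \<delta> \<subseteq> S \<delta>'" using d' by (auto simp: S_def)
    show "parabolic n \<delta> \<subseteq> parabolic n \<delta>'"
    proof
      fix Z assume "Z \<in> parabolic n \<delta>"
      then obtain X where X: "X \<in> (\<Pi> \<alpha>\<in>S \<delta>. root_space n \<alpha>)" and Z: "Z = F X \<delta>"
        unfolding par by blast
      define Y where "Y \<beta> = (if \<beta> \<in> S \<delta> then X \<beta> else 0\<^sub>m (n + n) (n + n))" for \<beta>
      have "Y \<in> (\<Pi> \<alpha>\<in>S \<delta>'. root_space n \<alpha>)"
        using X zero_in_root_space by (auto simp: Y_def)
      moreover have "F X \<delta> = F Y \<delta>'"
        unfolding F_def
      proof (rule cong_mat)
        fix i j assume "i < n + n" "j < n + n"
        thus "(\<Sum>\<alpha>\<in>S \<delta>. X \<alpha> $$ (i, j)) = (\<Sum>\<alpha>\<in>S \<delta>'. Y \<alpha> $$ (i, j))"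
          using fin sub by (intro sum.mono_neutral_cong_left) (auto simp: Y_def)
      qed auto
      ultimately show "Z \<in> parabolic n \<delta>'" unfolding par Z by blast
    qed
  qed
qed

section \<open>Root inequalities in integer coordinates\<close>

lemma Re_scalar_prod_root:
  fixes e :: "nat \<Rightarrow> int"
  assumes w: "w \<in> carrier_vec n" and we: "\<forall>i<n. w $ i = of_int (e i)" and ij: "i < n" "j < n"
  shows "Re (w \<bullet> (eps n i - eps n j)) = of_int (e i - e j)"
    and "Re (w \<bullet> (eps n i + eps n j)) = of_int (e i + e j)"
    and "Re (w \<bullet> (- eps n i - eps n j)) = of_int (- e i - e j)"
proof -
  have e: "w \<bullet> eps n i = of_int (e i)" "w \<bullet> eps n j = of_int (e j)"
    using we ij by simp_all
  have c: "eps n i \<in> carrier_vec n" "eps n j \<in> carrier_vec n" by simp_all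
  have c': "- eps n i \<in> carrier_vec n" using c by simp
  have u: "w \<bullet> - eps n i = - (w \<bullet> eps n i)"
    using w by (intro scalar_prod_uminus_right) simp
  show "Re (w \<bullet> (eps n i - eps n j)) = of_int (e i - e j)"
    and "Re (w \<bullet> (eps n i + eps n j)) = of_int (e i + e j)"
    and "Re (w \<bullet> (- eps n i - eps n j)) = of_int (- e i - e j)"
    unfolding scalar_prod_minus_distrib[OF w c] scalar_prod_add_distrib[OF w c]
      scalar_prod_minus_distrib[OF w c' c(2)] u e
    by simp_all
qed

text \<open>One conjunct for each family of roots. The middle one admits \<open>i = j\<close>
  because twice \<open>eps n i\<close> is a root; the last does not, because its negative is no
  root. This asymmetry is the source of the one-way change allowed in the last sign.\<close>

lemma parabolic_subset_coordinates:
  fixes d d' :: "nat \<Rightarrow> int"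
  assumes v: "v \<in> carrier_vec n" "\<And>i. i < n \<Longrightarrow> v $ i = of_int (d i)"
    and v': "v' \<in> carrier_vec n" "\<And>i. i < n \<Longrightarrow> v' $ i = of_int (d' i)"
  shows "parabolic n v \<subseteq> parabolic n v' \<longleftrightarrow>
    (\<forall>i<n. \<forall>j<n. (i \<noteq> j \<longrightarrow> d i \<ge> d j \<longrightarrow> d' i \<ge> d' j)
      \<and> (d i + d j \<ge> 0 \<longrightarrow> d' i + d' j \<ge> 0)
      \<and> (i \<noteq> j \<longrightarrow> d i + d j \<le> 0 \<longrightarrow> d' i + d' j \<le> 0))" (is "_ \<longleftrightarrow> ?R")
proof -
  have "\<forall>i<n. v $ i = of_int (d i)" "\<forall>i<n. v' $ i = of_int (d' i)" using v(2) v'(2) by auto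
  note form = Re_scalar_prod_root[OF v(1) this(1)] Re_scalar_prod_root[OF v'(1) this(2)]
  show ?thesis
    unfolding parabolic_subset_iff[OF v(1) v'(1)]
  proof
    assume L: "\<forall>\<alpha>\<in>roots n. 0 \<le> Re (v \<bullet> \<alpha>) \<longrightarrow> 0 \<le> Re (v' \<bullet> \<alpha>)"
    have 1: "d' i \<ge> d' j" if "i < n" "j < n" "i \<noteq> j" "d i \<ge> d j" for i j
    proof -
      have "eps n i - eps n j \<in> roots n"
        unfolding roots_def using that by (intro UnI1 UnI1 CollectI exI[of _ i] exI[of _ j]) simp
      from L[rule_format, OF this] show ?thesis using that by (simp add: form del: of_int_diff)
    qed
    have 2: "d' i + d' j \<ge> 0" if "i \<le> j" "j < n" "d i + d j \<ge> 0" for i j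
    proof -
      have "eps n i + eps n j \<in> roots n"
        unfolding roots_def using that by (intro UnI1 UnI2 CollectI exI[of _ i] exI[of _ j]) simp
      from L[rule_format, OF this] show ?thesis using that by (simp add: form del: of_int_add)
    qed
    have 3: "d' i + d' j \<le> 0" if "i < j" "j < n" "d i + d j \<le> 0" for i j
    proof -
      have "- eps n i - eps n j \<in> roots n"
        unfolding roots_def using that by (intro UnI2 CollectI exI[of _ i] exI[of _ j]) simp
      from L[rule_format, OF this] show ?thesis
        using that by (simp add: form del: of_int_minus of_int_diff)
    qed
    show ?R
    proof (intro allI impI conjI)
      fix i j assume ij: "i < n" "j < n"
      show "d' i \<ge> d' j" if "i \<noteq> j" "d i \<ge> d j"
        using 1 ij that by blast
      show "d' i + d' j \<ge> 0" if "d i + d j \<ge> 0"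
        using 2[of i j] 2[of j i] ij that by (cases "i \<le> j") (simp_all add: add.commute)
      show "d' i + d' j \<le> 0" if "i \<noteq> j" "d i + d j \<le> 0"
        using 3[of i j] 3[of j i] ij that by (cases "i < j") (simp_all add: add.commute)
    qed
  next
    assume R: ?R
    show "\<forall>\<alpha>\<in>roots n. 0 \<le> Re (v \<bullet> \<alpha>) \<longrightarrow> 0 \<le> Re (v' \<bullet> \<alpha>)"
    proof (intro ballI impI)
      fix \<alpha> assume nn: "0 \<le> Re (v \<bullet> \<alpha>)" and "\<alpha> \<in> roots n"
      from this(2) show "0 \<le> Re (v' \<bullet> \<alpha>)"
      proof (cases rule: roots_cases)
        case (minus i j)
        hence "d i \<ge> d j" using nn by (simp add: form del: of_int_diff)
        hence "d' i \<ge> d' j" using R minus(1-3) by blast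
        thus ?thesis using minus by (simp add: form del: of_int_diff)
      next
        case (plus i j)
        hence "i < n" "d i + d j \<ge> 0" using nn by (simp_all add: form del: of_int_add)
        hence "d' i + d' j \<ge> 0" using R plus(2) \<open>i < n\<close> by blast
        thus ?thesis using plus \<open>i < n\<close> by (simp add: form del: of_int_add)
      next
        case (neg i j)
        hence "i < n" "i \<noteq> j" "d i + d j \<le> 0"
          using nn by (simp_all add: form del: of_int_minus of_int_diff)
        hence "d' i + d' j \<le> 0" using R neg(2) by blast
        thus ?thesis using neg by (simp add: form del: of_int_minus of_int_diff)
      qed
    qed
  qed
qed

section \<open>Coordinates of the weight of a signed partition\<close>

definition pos_count :: "(nat \<Rightarrow> pm) \<Rightarrow> nat \<Rightarrow> nat" where
  "pos_count f i = card {j. j < i \<and> f j = Pos}"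

text \<open>The coordinate of the weight at which the part \<open>\<kappa> i\<close> is placed.\<close>

definition part_position :: "nat \<Rightarrow> (nat \<Rightarrow> pm) \<Rightarrow> nat \<Rightarrow> nat" where
  "part_position n f i = (if f i = Pos then pos_count f i else n - 1 - (i - pos_count f i))"

definition signed_part :: "(nat \<Rightarrow> int) \<Rightarrow> (nat \<Rightarrow> pm) \<Rightarrow> nat \<Rightarrow> int" where
  "signed_part \<kappa> f i = (if f i = Pos then \<kappa> i else - \<kappa> i)"

lemma pm_neq_Pos [simp]: "s \<noteq> Pos \<longleftrightarrow> s = Neg"
  by (cases s) auto

lemma pos_count_Suc: "pos_count f (Suc i) = (if f i = Pos then Suc (pos_count f i) else pos_count f i)"
proof -
  have "{j. j < Suc i \<and> f j = Pos} = (if f i = Pos then insert i {j. j < i \<and> f j = Pos} else {j. j < i \<and> f j = Pos})"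
    by (auto simp: less_Suc_eq)
  thus ?thesis unfolding pos_count_def by simp
qed

lemma pos_count_0 [simp]: "pos_count f 0 = 0"
  by (simp add: pos_count_def)

lemma pos_count_mono: "i \<le> j \<Longrightarrow> pos_count f i \<le> pos_count f j"
  by (induction j rule: dec_induct) (auto simp: pos_count_Suc)

text \<open>Each step adds at most one positive part; equivalently, the number
  \<open>i - pos_count f i\<close> of negative parts is monotone as well.\<close>

lemma pos_count_Lipschitz: "i \<le> j \<Longrightarrow> pos_count f j - pos_count f i \<le> j - i"
  by (induction j rule: dec_induct) (auto simp: pos_count_Suc)

lemma pos_count_le: "pos_count f i \<le> i"
  using pos_count_Lipschitz[of 0 i f] by simp

lemma pos_count_cong: "(\<And>j. j < i \<Longrightarrow> f j = g j) \<Longrightarrow> pos_count f i = pos_count g i"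
  unfolding pos_count_def by (metis (mono_tags, lifting))

lemma length_filter_Pos: "length (filter (\<lambda>j. f j = Pos) [0..<i]) = pos_count f i"
  by (induction i) (auto simp: pos_count_Suc)

lemma length_filter_Neg: "length (filter (\<lambda>j. f j = Neg) [0..<i]) = i - pos_count f i"
  by (induction i) (use pos_count_le[of f] in \<open>auto simp: pos_count_Suc Suc_diff_le\<close>)

text \<open>Cutting \<open>[0..<n]\<close> at \<open>i\<close> leaves a filtered prefix of exactly
  the indexed length, followed by \<open>i\<close>.\<close>

lemma filter_upt_nth:
  assumes "i < n" "P i"
  shows "filter P [0..<n] ! length (filter P [0..<i]) = i"
proof -
  have "[0..<n] = [0..<i] @ i # [Suc i..<n]"
    using assms(1) upt_add_eq_append[of 0 i "n - i"] upt_conv_Cons[of i n] by simp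
  thus ?thesis using assms(2) by (simp add: nth_append)
qed

lemma part_position_less: "i < n \<Longrightarrow> part_position n f i < n"
  using pos_count_le[of f i] by (auto simp: part_position_def)

text \<open>Positive parts fill the coordinates from the left and negative ones from the right; the
  two runs have \<open>n\<close> members together, so they never meet.\<close>

lemma part_position_inj: "inj_on (part_position n f) {..<n}"
proof -
  have "part_position n f i \<noteq> part_position n f j" if "i < j" "j < n" for i j
    using that pos_count_mono[of "Suc i" j f] pos_count_Lipschitz[of "Suc i" j f]
      pos_count_le[of f i] pos_count_le[of f j]
    by (auto simp: part_position_def pos_count_Suc split: if_splits)
  thus ?thesis by (intro linorder_inj_onI) auto
qed

lemma part_position_bij: "bij_betw (part_position n f) {..<n} {..<n}"
  using part_position_inj[of n f]
  by (intro bij_betw_imageI endo_inj_surj) (auto simp: part_position_less)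

lemma part_position_surj:
  assumes "c < n" obtains i where "i < n" "part_position n f i = c"
  using assms part_position_bij[of n f] unfolding bij_betw_def by (metis imageE lessThan_iff)

section \<open>Coordinates of the weight\<close>

lemma bipartition_weight_nth:
  assumes "c < n" "length \<mu> \<le> n" "length \<nu> \<le> n"
  shows "bipartition_weight n \<mu> \<nu> $ c =
    (if c < length \<mu> then of_int (\<mu> ! c) else 0)
    - (if n - 1 - c < length \<nu> then of_int (\<nu> ! (n - 1 - c)) else 0)"
proof -
  have 1: "finsum_vec TYPE(complex) n (\<lambda>i. of_int (\<mu> ! i) \<cdot>\<^sub>v eps n i) {..<length \<mu>} $ c
      = (if c < length \<mu> then of_int (\<mu> ! c) else 0)"
  proof -
    have "finsum_vec TYPE(complex) n (\<lambda>i. of_int (\<mu> ! i) \<cdot>\<^sub>v eps n i) {..<length \<mu>} $ c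
        = (\<Sum>i<length \<mu>. (of_int (\<mu> ! i) \<cdot>\<^sub>v eps n i) $ c)"
      using assms by (intro index_finsum_vec) auto
    also have "\<dots> = (\<Sum>i<length \<mu>. if i = c then of_int (\<mu> ! c) else 0)"
      using assms by (intro sum.cong) auto
    finally show ?thesis by simp
  qed
  have 2: "finsum_vec TYPE(complex) n (\<lambda>j. of_int (\<nu> ! j) \<cdot>\<^sub>v eps n (n - 1 - j)) {..<length \<nu>} $ c
      = (if n - 1 - c < length \<nu> then of_int (\<nu> ! (n - 1 - c)) else 0)"
  proof -
    have "finsum_vec TYPE(complex) n (\<lambda>j. of_int (\<nu> ! j) \<cdot>\<^sub>v eps n (n - 1 - j)) {..<length \<nu>} $ c
        = (\<Sum>j<length \<nu>. (of_int (\<nu> ! j) \<cdot>\<^sub>v eps n (n - 1 - j)) $ c)"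
      using assms by (intro index_finsum_vec) auto
    \<comment> \<open>For \<open>j < n\<close> the equation \<open>n - 1 - j = c\<close> can be
      solved for \<open>j\<close>; the length bound guarantees this despite truncated
      subtraction.\<close>
    also have "\<dots> = (\<Sum>j<length \<nu>. if j = n - 1 - c then of_int (\<nu> ! (n - 1 - c)) else 0)"
      using assms by (intro sum.cong) auto
    finally show ?thesis by simp
  qed
  have "dim_vec (finsum_vec TYPE(complex) n (\<lambda>j. of_int (\<nu> ! j) \<cdot>\<^sub>v eps n (n - 1 - j)) {..<length \<nu>}) = n"
    by (intro carrier_vecD finsum_vec_closed) auto
  thus ?thesis unfolding bipartition_weight_def using 1 2 assms(1) by simp
qed

lemma bipartition_weight_carrier: "bipartition_weight n \<mu> \<nu> \<in> carrier_vec n"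
  unfolding bipartition_weight_def by (intro minus_carrier_vec finsum_vec_closed) auto

text \<open>The two lists have \<open>n\<close> parts together, so every coordinate receives a
  contribution from exactly one of the two sums.\<close>

lemma bipartition_weight_part_position:
  assumes i: "i < n"
  shows "bipartition_weight n (parts_of_sign n Pos (\<kappa>, f)) (parts_of_sign n Neg (\<kappa>, f))
      $ part_position n f i = of_int (signed_part \<kappa> f i)"
proof -
  define \<mu> where "\<mu> = parts_of_sign n Pos (\<kappa>, f)"
  define \<nu> where "\<nu> = parts_of_sign n Neg (\<kappa>, f)"
  have len: "length \<mu> = pos_count f n" "length \<nu> = n - pos_count f n"
    by (simp_all add: \<mu>_def \<nu>_def parts_of_sign_def length_filter_Pos length_filter_Neg)
  have "pos_count f n \<le> n" by (rule pos_count_le)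
  note w = bipartition_weight_nth[of _ n \<mu> \<nu>, unfolded len]
  have le: "pos_count f i \<le> i" by (rule pos_count_le)
  \<comment> \<open>Counting up to \<open>Suc i\<close> includes part \<open>i\<close> itself, which
    gives the strict bounds that place it inside its list.\<close>
  have m: "pos_count f (Suc i) \<le> pos_count f n" "pos_count f n - pos_count f (Suc i) \<le> n - Suc i"
    using i pos_count_mono[of "Suc i" n f] pos_count_Lipschitz[of "Suc i" n f] by auto
  show ?thesis
  proof (cases "f i = Pos")
    case True
    have lt: "pos_count f i < pos_count f n" using m True by (simp add: pos_count_Suc)
    moreover have "\<mu> ! pos_count f i = \<kappa> i"
      using lt len filter_upt_nth[of i n "\<lambda>j. f j = Pos"] i True
      by (simp add: \<mu>_def parts_of_sign_def length_filter_Pos)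
    ultimately show ?thesis
      using True i le \<open>pos_count f n \<le> n\<close>
      by (simp add: \<mu>_def[symmetric] \<nu>_def[symmetric] part_position_def signed_part_def w)
  next
    case False
    have lt: "i - pos_count f i < n - pos_count f n" using m False i le by (simp add: pos_count_Suc)
    moreover have "\<nu> ! (i - pos_count f i) = \<kappa> i"
      using lt len filter_upt_nth[of i n "\<lambda>j. f j = Neg"] i False
      by (simp add: \<nu>_def parts_of_sign_def length_filter_Neg)
    moreover have "n - 1 - (n - 1 - (i - pos_count f i)) = i - pos_count f i"
      using i by simp
    ultimately show ?thesis
      using False i le \<open>pos_count f n \<le> n\<close>
      by (simp add: \<mu>_def[symmetric] \<nu>_def[symmetric] part_position_def signed_part_def w)
  qed
qed

section \<open>Comparison of signed partitions\<close>

text \<open>The last part takes the one coordinate left free, whichever side it is filled from, so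
  its sign does not influence the positions.\<close>

lemma part_position_eqI:
  assumes "\<And>j. j < n - 1 \<Longrightarrow> f j = g j" "i < n"
  shows "part_position n f i = part_position n g i"
proof -
  have c: "pos_count f i = pos_count g i"
    using assms by (intro pos_count_cong) auto
  show ?thesis
  proof (cases "i < n - 1")
    case True
    thus ?thesis using c assms by (simp add: part_position_def)
  next
    case False
    hence "i = n - 1" using assms(2) by simp
    moreover have "n - 1 - (i - pos_count g i) = pos_count g i"
      using \<open>i = n - 1\<close> pos_count_le[of g i] by simp
    ultimately show ?thesis using c by (simp add: part_position_def)
  qed
qed

text \<open>Parts are positive exactly below \<open>n\<close> because the support of a decreasing
  sequence is an initial segment, here with \<open>n\<close> elements.\<close>

lemma signed_partitionsD:
  assumes "(\<kappa>, f) \<in> signed_partitions n"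
  shows "antimono \<kappa>" "finite {i. \<kappa> i \<noteq> 0}" "\<kappa> i \<ge> 0"
    and "\<kappa> i \<ge> 1 \<longleftrightarrow> i < n" "\<kappa> i - \<kappa> (Suc i) \<le> 1" "\<kappa> i \<ge> \<kappa> (Suc i)"
    and "i < n \<Longrightarrow> j < n \<Longrightarrow> \<kappa> i = \<kappa> j \<Longrightarrow> f i = f j"
proof -
  have part: "is_partition \<kappa>" and len: "card {i. \<kappa> i \<noteq> 0} = n"
    using assms by (auto simp: signed_partitions_def RP0_def partition_length_def)
  show am: "antimono \<kappa>" and fin: "finite {i. \<kappa> i \<noteq> 0}" and nn: "\<kappa> i \<ge> 0" for i
    using part by (auto simp: is_partition_def)
  have steps: "\<forall>i. 0 \<le> \<kappa> i - \<kappa> (Suc i) \<and> \<kappa> i - \<kappa> (Suc i) \<le> 1"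
    and signs: "\<forall>i<n. \<forall>j<n. \<kappa> i = \<kappa> j \<longrightarrow> f i = f j"
    using assms unfolding signed_partitions_def RP0_def by blast+
  show "\<kappa> i - \<kappa> (Suc i) \<le> 1" "\<kappa> i \<ge> \<kappa> (Suc i)"
    using spec[OF steps, of i] by simp_all
  show "i < n \<Longrightarrow> j < n \<Longrightarrow> \<kappa> i = \<kappa> j \<Longrightarrow> f i = f j"
    using signs by blast
  have "i < n" if "\<kappa> i \<noteq> 0"
  proof -
    have "{..i} \<subseteq> {i. \<kappa> i \<noteq> 0}"
    proof
      fix j assume "j \<in> {..i}"
      hence "\<kappa> j \<ge> \<kappa> i" using antimonoD[OF am, of j i] by simp
      thus "j \<in> {i. \<kappa> i \<noteq> 0}" using that nn[of i] by simp
    qed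
    from card_mono[OF fin this] show ?thesis using len by simp
  qed
  moreover have "\<kappa> i \<noteq> 0" if "i < n"
  proof
    assume z: "\<kappa> i = 0"
    have "{i. \<kappa> i \<noteq> 0} \<subseteq> {..<i}"
    proof
      fix j assume "j \<in> {i. \<kappa> i \<noteq> 0}"
      thus "j \<in> {..<i}"
        using antimonoD[OF am, of i j] z nn[of j] by (cases "i \<le> j") auto
    qed
    from card_mono[OF _ this] show False using len that by simp
  qed
  ultimately show "\<kappa> i \<ge> 1 \<longleftrightarrow> i < n" using nn[of i] by fastforce
qed

section \<open>Compatible coordinates and agreement of signs\<close>

definition pairwise_compatible :: "nat \<Rightarrow> (nat \<Rightarrow> int) \<Rightarrow> (nat \<Rightarrow> int) \<Rightarrow> bool" where
  "pairwise_compatible n d d' \<longleftrightarrow>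
    (\<forall>i<n. \<forall>j<n. (i \<noteq> j \<longrightarrow> d i \<ge> d j \<longrightarrow> d' i \<ge> d' j)
      \<and> (d i + d j \<ge> 0 \<longrightarrow> d' i + d' j \<ge> 0)
      \<and> (i \<noteq> j \<longrightarrow> d i + d j \<le> 0 \<longrightarrow> d' i + d' j \<le> 0))"

text \<open>At the first disagreement \<open>i\<close>, let \<open>a\<close> and \<open>b\<close> be
  the coordinates at which \<open>f\<close> and \<open>f'\<close> place part \<open>i\<close>. On
  this pair a largest part of \<kappa> sits at \<open>a\<close> and a largest part of \<kappa>' at
  \<open>b\<close>, with opposite signs. Compatibility of the sums then forces the two parts of
  \<kappa>' to cancel.\<close>

lemma signs_agree:
  assumes p: "(\<kappa>, f) \<in> signed_partitions n" and p': "(\<kappa>', f') \<in> signed_partitions n"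
    and d: "\<And>i. i < n \<Longrightarrow> d (part_position n f i) = signed_part \<kappa> f i"
    and d': "\<And>i. i < n \<Longrightarrow> d' (part_position n f' i) = signed_part \<kappa>' f' i"
    and comp: "pairwise_compatible n d d'"
    and i: "i < n - 1"
  shows "f i = f' i"
  using i
proof (induction i rule: less_induct)
  case (less i)
  note D = signed_partitionsD[OF p] and D' = signed_partitionsD[OF p']
  have eq: "f j = f' j" if "j < i" for j using less that by simp
  have i: "i < n" "i < n - 1" using less.prems by simp_all
  show ?case
  proof (rule ccontr)
    assume ne: "f i \<noteq> f' i"
    define a where "a = part_position n f i"
    define b where "b = part_position n f' i"
    have c: "pos_count f i = pos_count f' i" using eq by (rule pos_count_cong)
    have ab: "a < n" "b < n" unfolding a_def b_def using i part_position_less by auto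
    \<comment> \<open>Equality would mean
      \<open>pos_count f i = n - 1 - (i - pos_count f i)\<close>, that is
      \<open>i = n - 1\<close>.\<close>
    have "a \<noteq> b"
      unfolding a_def b_def part_position_def c
      using ne i pos_count_le[of f' i] by (cases "f i"; cases "f' i") auto
    have pos_eq: "part_position n f j = part_position n f' j" if "j < i" for j
      using that eq pos_count_cong[of j f f'] by (simp add: part_position_def)
    obtain j where j: "j < n" "part_position n f j = b" using part_position_surj[OF ab(2)] by blast
    obtain j' where j': "j' < n" "part_position n f' j' = a" using part_position_surj[OF ab(1)] by blast
    \<comment> \<open>Parts before \<open>i\<close> occupy the same coordinates for both sign
      functions, so they take neither \<open>a\<close> nor \<open>b\<close>.\<close>
    have "i \<le> j"
    proof (rule ccontr)
      assume "\<not> i \<le> j"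
      hence "part_position n f' j = part_position n f' i" using pos_eq j by (simp add: b_def)
      thus False using part_position_inj[of n f'] j i \<open>\<not> i \<le> j\<close> by (simp add: inj_on_eq_iff)
    qed
    have "i \<le> j'"
    proof (rule ccontr)
      assume "\<not> i \<le> j'"
      hence "part_position n f j' = part_position n f i" using pos_eq j' by (simp add: a_def)
      thus False using part_position_inj[of n f] j' i \<open>\<not> i \<le> j'\<close> by (simp add: inj_on_eq_iff)
    qed
    have k: "\<kappa> j \<le> \<kappa> i" "\<kappa>' j' \<le> \<kappa>' i"
      using antimonoD[OF D(1) \<open>i \<le> j\<close>] antimonoD[OF D'(1) \<open>i \<le> j'\<close>] .
    have pos: "\<kappa> j \<ge> 1" "\<kappa>' j' \<ge> 1" "\<kappa>' i \<ge> 1"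
      using D(4) D'(4) i j j' by blast+
    have da: "d a = signed_part \<kappa> f i" and db: "d b = signed_part \<kappa> f j"
      using d i j by (auto simp: a_def)
    have da': "d' a = signed_part \<kappa>' f' j'" and db': "d' b = signed_part \<kappa>' f' i"
      using d' i j' by (auto simp: b_def)
    have R: "d a + d b \<ge> 0 \<longrightarrow> d' a + d' b \<ge> 0" "d a + d b \<le> 0 \<longrightarrow> d' a + d' b \<le> 0"
      using comp ab \<open>a \<noteq> b\<close> unfolding pairwise_compatible_def by blast+
    \<comment> \<open>If \<open>f i = Pos\<close>, then \<open>d a + d b\<close> is nonnegative,
      while \<open>d' b\<close> is the negative of a largest part of \<kappa>' on the pair;
      \<open>d' a + d' b\<close> can be nonnegative only if \<open>d' a\<close> cancels it. The
      other case is dual.\<close>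
    have "\<kappa>' j' = \<kappa>' i \<and> f' j' \<noteq> f' i"
    proof (cases "f i")
      case Pos
      hence "f' i = Neg" using ne by (cases "f' i") auto
      thus ?thesis using R(1) da db da' db' k pos Pos
        by (cases "f j"; cases "f' j'") (auto simp: signed_part_def)
    next
      case Neg
      hence "f' i = Pos" using ne by (cases "f' i") auto
      thus ?thesis using R(2) da db da' db' k pos Neg
        by (cases "f j"; cases "f' j'") (auto simp: signed_part_def)
    qed
    thus False using D'(7)[OF j'(1) i(1)] by simp
  qed
qed

text \<open>Only pairs of coordinates are compared, so permuting both weights by the same bijection
  changes nothing; injectivity preserves \<open>i \<noteq> j\<close>.\<close>

lemma pairwise_compatible_reindex:
  assumes bij: "bij_betw \<sigma> {..<n} {..<n}"
    and d: "\<And>i. i < n \<Longrightarrow> d (\<sigma> i) = e i" and d': "\<And>i. i < n \<Longrightarrow> d' (\<sigma> i) = e' i"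
  shows "pairwise_compatible n d d' \<longleftrightarrow> pairwise_compatible n e e'"
proof -
  define P where "P d d' i j \<longleftrightarrow> (i \<noteq> j \<longrightarrow> d i \<ge> d j \<longrightarrow> d' i \<ge> d' j)
      \<and> (d i + d j \<ge> 0 \<longrightarrow> d' i + d' j \<ge> 0)
      \<and> (i \<noteq> j \<longrightarrow> d i + d j \<le> 0 \<longrightarrow> d' i + d' j \<le> 0)" for d d' :: "nat \<Rightarrow> int" and i j
  have im: "\<sigma> ` {..<n} = {..<n}" and inj: "inj_on \<sigma> {..<n}"
    using bij by (auto simp: bij_betw_def)
  have P: "P d d' (\<sigma> i) (\<sigma> j) \<longleftrightarrow> P e e' i j" if "i < n" "j < n" for i j
    using that inj by (simp add: P_def d d' inj_on_eq_iff)
  have "pairwise_compatible n d d' \<longleftrightarrow> (\<forall>x\<in>\<sigma> ` {..<n}. \<forall>y\<in>\<sigma> ` {..<n}. P d d' x y)"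
    unfolding im pairwise_compatible_def P_def by auto
  also have "\<dots> \<longleftrightarrow> (\<forall>i<n. \<forall>j<n. P e e' i j)" using P by auto
  also have "\<dots> \<longleftrightarrow> pairwise_compatible n e e'" unfolding pairwise_compatible_def P_def ..
  finally show ?thesis .
qed

section \<open>Compatibility and the partial order\<close>

text \<open>Both sequences drop by 0 or 1 at each step, so the difference can only increase where
  \<kappa> is constant and \<kappa>' drops. There equal signs and the two root inequalities between
  neighbours force \<kappa>' to be constant too.\<close>

lemma signed_partition_le_if_compatible:
  assumes n: "n \<ge> 1"
    and p: "(\<kappa>, f) \<in> signed_partitions n" and p': "(\<kappa>', f') \<in> signed_partitions n"
    and agree: "\<And>i. i < n - 1 \<Longrightarrow> f i = f' i"
    and comp: "pairwise_compatible n (signed_part \<kappa> f) (signed_part \<kappa>' f')"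
  shows "signed_partition_le n (\<kappa>, f) (\<kappa>', f')"
proof -
  note D = signed_partitionsD[OF p] and D' = signed_partitionsD[OF p']
  have last: "f' (n - 1) = Pos" if "f (n - 1) = Pos"
  proof -
    \<comment> \<open>The pair \<open>(n - 1, n - 1)\<close>, belonging to the root twice
      \<open>eps n (n - 1)\<close>, forbids a change from \<open>Pos\<close> to
      \<open>Neg\<close>.\<close>
    have "signed_part \<kappa> f (n - 1) + signed_part \<kappa> f (n - 1) \<ge> 0"
      using that D(3)[of "n - 1"] by (simp add: signed_part_def)
    moreover have "n - 1 < n" using n by simp
    ultimately have "signed_part \<kappa>' f' (n - 1) + signed_part \<kappa>' f' (n - 1) \<ge> 0"
      using comp unfolding pairwise_compatible_def by blast
    thus ?thesis using D'(4)[of "n - 1"] n by (auto simp: signed_part_def split: if_splits)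
  qed
  have zero: "\<kappa> i = 0" "\<kappa>' i = 0" if "i \<ge> n" for i
    using that D(3,4)[of i] D'(3,4)[of i] by auto
  have "\<kappa> (Suc i) - \<kappa>' (Suc i) \<le> \<kappa> i - \<kappa>' i" for i
  proof (cases "Suc i < n")
    case False
    \<comment> \<open>At \<open>i = n - 1\<close> both parts equal 1, being at least 1 and followed
      by 0; beyond that both vanish.\<close>
    have "\<kappa> i = \<kappa>' i"
      using False zero[of i] zero[of "Suc i"] D(4,5)[of i] D'(4,5)[of i]
      by (cases "i < n") auto
    thus ?thesis using zero[of "Suc i"] False by simp
  next
    case True
    have "\<kappa>' i \<le> \<kappa>' (Suc i)" if eq: "\<kappa> i = \<kappa> (Suc i)"
    proof -
      have f: "f i = f (Suc i)" using D(7)[of i "Suc i"] eq True by simp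
      have f': "f' i = f i" using agree True by simp
      have "signed_part \<kappa> f i = signed_part \<kappa> f (Suc i)"
        using eq f by (simp add: signed_part_def)
      moreover have "i < n" using True by simp
      ultimately have R: "signed_part \<kappa>' f' i \<ge> signed_part \<kappa>' f' (Suc i)" "signed_part \<kappa>' f' (Suc i) \<ge> signed_part \<kappa>' f' i"
        using comp True unfolding pairwise_compatible_def by (metis n_not_Suc_n order_refl)+
      have "\<kappa>' i \<ge> 1" "\<kappa>' (Suc i) \<ge> 1" using D'(4) True by auto
      thus ?thesis using R by (auto simp: signed_part_def split: if_splits)
    qed
    thus ?thesis using D(5,6)[of i] D'(5,6)[of i] by (cases "\<kappa> i = \<kappa> (Suc i)") auto
  qed
  hence anti: "antimono (\<lambda>i. \<kappa> i - \<kappa>' i)"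
    by (intro decseq_SucI)
  \<comment> \<open>A decreasing difference is bounded below by its value past the last part, which
    is 0.\<close>
  have "\<kappa> i - \<kappa>' i \<ge> 0" for i
    using antimonoD[OF anti, of i "max i n"] zero[of "max i n"] by simp
  moreover have "finite {i. \<kappa> i - \<kappa>' i \<noteq> 0}"
    using D(2) D'(2) by (rule rev_finite_subset[OF finite_UnI]) auto
  ultimately have "is_partition (\<lambda>i. \<kappa> i - \<kappa>' i)" using anti by (simp add: is_partition_def)
  thus ?thesis
    using agree last by (cases "f (n - 1)"; cases "f' (n - 1)") (auto simp: signed_partition_le_def)
qed

text \<open>For \<open>i < j\<close> with distinct parts of \<kappa>, the larger part decides both
  the order and the sign of the sum, and its sign is unchanged because \<open>i\<close> is not last.
  Equal parts of \<kappa> give equal parts of \<kappa>', as the difference decreases.\<close>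

lemma compatible_if_signed_partition_le:
  assumes p: "(\<kappa>, f) \<in> signed_partitions n" and p': "(\<kappa>', f') \<in> signed_partitions n"
    and le: "signed_partition_le n (\<kappa>, f) (\<kappa>', f')"
  shows "pairwise_compatible n (signed_part \<kappa> f) (signed_part \<kappa>' f')"
proof -
  note D = signed_partitionsD[OF p] and D' = signed_partitionsD[OF p']
  have anti: "antimono (\<lambda>i. \<kappa> i - \<kappa>' i)" and agree: "\<And>i. i < n - 1 \<Longrightarrow> f i = f' i"
    and last: "(f (n - 1), f' (n - 1)) \<in> {(Neg, Pos), (Pos, Pos), (Neg, Neg)}"
    using le by (auto simp: signed_partition_le_def is_partition_def)
  define x where "x = signed_part \<kappa> f"
  define y where "y = signed_part \<kappa>' f'"
  have sign: "f' i = Pos" if "f i = Pos" "i < n" for i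
    using that agree last by (cases "i = n - 1") auto
  have main: "(x i \<ge> x j \<longrightarrow> y i \<ge> y j) \<and> (x j \<ge> x i \<longrightarrow> y j \<ge> y i)
      \<and> (x i + x j \<ge> 0 \<longrightarrow> y i + y j \<ge> 0) \<and> (x i + x j \<le> 0 \<longrightarrow> y i + y j \<le> 0)"
    if ij: "i < j" "j < n" for i j
  proof -
    have k: "\<kappa> i \<ge> \<kappa> j" "\<kappa>' i \<ge> \<kappa>' j" "\<kappa> i - \<kappa>' i \<ge> \<kappa> j - \<kappa>' j"
      using ij antimonoD[OF D(1)] antimonoD[OF D'(1)] antimonoD[OF anti] by simp_all
    have pos: "\<kappa> j \<ge> 1" "\<kappa>' j \<ge> 1" using D(4) D'(4) ij by auto
    have fi: "f' i = f i" using agree ij by simp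
    show ?thesis
    proof (cases "\<kappa> i = \<kappa> j")
      case True
      hence k': "\<kappa>' i = \<kappa>' j" using k by simp
      have "f i = f j" "f' i = f' j" using D(7)[of i j] D'(7)[of i j] True k' ij by simp_all
      thus ?thesis using True k' fi pos by (auto simp: x_def y_def signed_part_def)
    next
      case False
      hence "\<kappa> i > \<kappa> j" using k by simp
      moreover have "f j = Pos \<Longrightarrow> f' j = Pos" using sign ij by simp
      ultimately show ?thesis
        using k pos fi unfolding x_def y_def signed_part_def
        by (cases "f i"; cases "f j"; cases "f' j") auto
    qed
  qed
  \<comment> \<open>The diagonal pairs rest on the fact that a positive sign never becomes
    negative.\<close>
  have diag: "y i + y i \<ge> 0" if "i < n" "x i + x i \<ge> 0" for i
    using that sign[of i] D(4)[of i] D'(3)[of i]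
    by (cases "f i") (auto simp: x_def y_def signed_part_def)
  show ?thesis
    unfolding pairwise_compatible_def x_def[symmetric] y_def[symmetric]
  proof (intro allI impI conjI)
    fix i j assume ij: "i < n" "j < n"
    show "y i \<ge> y j" if "i \<noteq> j" "x i \<ge> x j"
      using main[of i j] main[of j i] that ij by (cases "i < j") auto
    show "y i + y j \<ge> 0" if "x i + x j \<ge> 0"
      using main[of i j] main[of j i] that ij diag[of i]
      by (cases i j rule: linorder_cases) (auto simp: add.commute)
    show "y i + y j \<le> 0" if "i \<noteq> j" "x i + x j \<le> 0"
      using main[of i j] main[of j i] that ij by (cases "i < j") (auto simp: add.commute)
  qed
qed

theorem proposition5p15:
  fixes n :: nat and \<kappa> \<kappa>' :: "nat \<Rightarrow> int" and f f' :: "nat \<Rightarrow> pm"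
  assumes "n \<ge> 1"
    and "(\<kappa>, f) \<in> signed_partitions n"
    and "(\<kappa>', f') \<in> signed_partitions n"
  shows "reduced_parabolic n (\<kappa>, f) \<subseteq> reduced_parabolic n (\<kappa>', f')
         \<longleftrightarrow> signed_partition_le n (\<kappa>, f) (\<kappa>', f')"
proof -
  define w where "w \<kappa> f = bipartition_weight n (parts_of_sign n Pos (\<kappa>, f)) (parts_of_sign n Neg (\<kappa>, f))"
    for \<kappa> f
  \<comment> \<open>Coordinates are read through the inverse of \<open>part_position\<close>, so at
    first each weight comes with its own permutation.\<close>
  define d where "d \<kappa> f c = signed_part \<kappa> f (inv_into {..<n} (part_position n f) c)" for \<kappa> f c
  have d: "d \<kappa> f (part_position n f i) = signed_part \<kappa> f i" if "i < n" for \<kappa> f i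
    using that by (simp add: d_def inv_into_f_f[OF part_position_inj])
  have w: "w \<kappa> f $ c = of_int (d \<kappa> f c)" if "c < n" for \<kappa> f c
    using part_position_surj[OF that, of f] bipartition_weight_part_position[of _ n \<kappa> f] d
    unfolding w_def by metis
  have red: "reduced_parabolic n (\<kappa>, f) \<subseteq> reduced_parabolic n (\<kappa>', f')
      \<longleftrightarrow> pairwise_compatible n (d \<kappa> f) (d \<kappa>' f')"
    unfolding reduced_parabolic_def w_def[symmetric] pairwise_compatible_def
    by (rule parabolic_subset_coordinates) (auto simp: w, auto simp: w_def bipartition_weight_carrier)
  \<comment> \<open>Once the signs agree before the last index, \<open>part_position n f\<close> and
    \<open>part_position n f'\<close> coincide below \<open>n\<close>, and one permutation serves
    both weights.\<close>
  have transfer: "pairwise_compatible n (d \<kappa> f) (d \<kappa>' f') \<longleftrightarrow>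
      pairwise_compatible n (signed_part \<kappa> f) (signed_part \<kappa>' f')"
    if "\<And>i. i < n - 1 \<Longrightarrow> f i = f' i"
  proof (rule pairwise_compatible_reindex[OF part_position_bij[of n f]])
    show "d \<kappa>' f' (part_position n f i) = signed_part \<kappa>' f' i" if "i < n" for i
      using part_position_eqI[of n f f' i] \<open>\<And>i. i < n - 1 \<Longrightarrow> f i = f' i\<close> that by (simp add: d)
  qed (rule d)
  show ?thesis
  proof
    assume "reduced_parabolic n (\<kappa>, f) \<subseteq> reduced_parabolic n (\<kappa>', f')"
    hence comp: "pairwise_compatible n (d \<kappa> f) (d \<kappa>' f')" by (simp add: red)
    have agree: "f i = f' i" if "i < n - 1" for i
      by (rule signs_agree[OF assms(2,3) d d comp that])
    show "signed_partition_le n (\<kappa>, f) (\<kappa>', f')"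
      using signed_partition_le_if_compatible[OF assms agree] transfer[OF agree] comp by blast
  next
    assume le: "signed_partition_le n (\<kappa>, f) (\<kappa>', f')"
    hence "f i = f' i" if "i < n - 1" for i using that by (simp add: signed_partition_le_def)
    thus "reduced_parabolic n (\<kappa>, f) \<subseteq> reduced_parabolic n (\<kappa>', f')"
      unfolding red using compatible_if_signed_partition_le[OF assms(2,3) le] transfer by blast
  qed
qed

end
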